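(* Let $A$ be a finite alphabet and $\Sigma=A^{\mathbb Z}$. (1) Suppose $d$ is an ultrametric which induces the product topology on $\Sigma$ and let $\delta>0$. Then $D^d_\delta$ is a pseudometric on $\Sigma$. (2) Let $d$ and $d'$ be two metrics which induce the product topology on $\Sigma$, and let $\delta\in(0,\delta_0^d]$ and $\delta'\in(0,\delta_0^{d'}]$. Then there are $c,C>0$ such that $$c\cdot D^d_\delta(x,y)\le D^{d'}_{\delta'}(x,y)\le C\cdot D^d_\delta(x,y)\qquad\text{for all }x,y\in\Sigma.$$
   Context: $\sigma((x_n)_n)=(x_{n+1})_n$ is the left shift on $\Sigma$. For a metric $d$ on $\Sigma$ and $\delta>0$, $$D^d_\delta(x,y)=\limsup_{n\to\infty}\frac{\#\{0\le k\le n-1: d(\sigma^k(x),\sigma^k(y))\ge\delta\}}{n}\qquad(x,y\in\Sigma).$$ For a metric $d$ inducing the product topology on $\Sigma$, $\delta_0^d>0$ denotes a (fixed) number such that $d(x,y)\ge\delta_0^d$ whenever $x=(x_k)_{k\in\mathbb Z}$, $y=(y_k)_{k\in\mathbb Z}\in\Sigma$ satisfy $x_0\ne y_0$. *)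

theory Defs
  imports "HOL-Analysis.Analysis"
begin

text \<open>The alphabet is a finite type \<open>'a\<close>, so the full two-sided shift is the type \<open>int \<Rightarrow> 'a\<close>.\<close>

definition shift :: "(int \<Rightarrow> 'a) \<Rightarrow> (int \<Rightarrow> 'a)" where
  "shift x = (\<lambda>n. x (n + 1))"

definition metric_inducing_product_topology :: "((int \<Rightarrow> 'a) \<Rightarrow> (int \<Rightarrow> 'a) \<Rightarrow> real) \<Rightarrow> bool" where
  "metric_inducing_product_topology d \<longleftrightarrow>
     Metric_space UNIV d \<and>
     Metric_space.mtopology UNIV d = product_topology (\<lambda>_. discrete_topology UNIV) UNIV"

definition ultrametric :: "('b \<Rightarrow> 'b \<Rightarrow> real) \<Rightarrow> bool" where
  "ultrametric d \<longleftrightarrow> Metric_space UNIV d \<and> (\<forall>x y z. d x z \<le> max (d x y) (d y z))"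

definition pseudometric :: "('b \<Rightarrow> 'b \<Rightarrow> real) \<Rightarrow> bool" where
  "pseudometric D \<longleftrightarrow>
     (\<forall>x y. 0 \<le> D x y) \<and> (\<forall>x. D x x = 0) \<and> (\<forall>x y. D x y = D y x) \<and>
     (\<forall>x y z. D x z \<le> D x y + D y z)"

definition separation_freq ::
  "((int \<Rightarrow> 'a) \<Rightarrow> (int \<Rightarrow> 'a) \<Rightarrow> real) \<Rightarrow> real \<Rightarrow> (int \<Rightarrow> 'a) \<Rightarrow> (int \<Rightarrow> 'a) \<Rightarrow> nat \<Rightarrow> real" where
  "separation_freq d \<delta> x y n =
     real (card {k. k < n \<and> d ((shift ^^ k) x) ((shift ^^ k) y) \<ge> \<delta>}) / real n"

text \<open>The library's \<open>limsup\<close> needs a complete lattice, so it is taken in the extended reals. As the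
  frequencies lie in the unit interval, no information is lost in passing back to the reals; see
  \<open>ereal_D_dist\<close>.\<close>

definition D_dist ::
  "((int \<Rightarrow> 'a) \<Rightarrow> (int \<Rightarrow> 'a) \<Rightarrow> real) \<Rightarrow> real \<Rightarrow> (int \<Rightarrow> 'a) \<Rightarrow> (int \<Rightarrow> 'a) \<Rightarrow> real" where
  "D_dist d \<delta> x y = real_of_ereal (limsup (\<lambda>n. ereal (separation_freq d \<delta> x y n)))"

lemma separation_freq_bounds: "0 \<le> separation_freq d \<delta> x y n" "separation_freq d \<delta> x y n \<le> 1"
proof -
  have "card {k. k < n \<and> d ((shift ^^ k) x) ((shift ^^ k) y) \<ge> \<delta>} \<le> card {..<n}"
    by (rule card_mono) auto
  then show "separation_freq d \<delta> x y n \<le> 1"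
    by (cases "n = 0") (simp_all add: separation_freq_def)
qed (simp add: separation_freq_def)

lemma ereal_D_dist: "ereal (D_dist d \<delta> x y) = limsup (\<lambda>n. ereal (separation_freq d \<delta> x y n))"
proof -
  let ?L = "limsup (\<lambda>n. ereal (separation_freq d \<delta> x y n))"
  have "0 \<le> ?L"
    by (rule le_Limsup) (simp_all add: separation_freq_bounds)
  moreover have "?L \<le> 1"
    by (rule Limsup_bounded) (simp add: separation_freq_bounds)
  ultimately have "\<bar>?L\<bar> \<noteq> \<infinity>" by auto
  then show ?thesis by (simp add: D_dist_def ereal_real')
qed

text \<open>Admissible values of the constant \<open>\<delta>\<^sub>0\<close> attached to \<open>d\<close>. It is not unique, hence
  a predicate.\<close>

definition is_delta0 :: "((int \<Rightarrow> 'a) \<Rightarrow> (int \<Rightarrow> 'a) \<Rightarrow> real) \<Rightarrow> real \<Rightarrow> bool" where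
  "is_delta0 d \<delta>\<^sub>0 \<longleftrightarrow> \<delta>\<^sub>0 > 0 \<and> (\<forall>x y. x 0 \<noteq> y 0 \<longrightarrow> d x y \<ge> \<delta>\<^sub>0)"

end

theory Submission
  imports Defs
begin

text \<open>
  Throughout, \<^const>\<open>D_dist\<close> is the upper density of the set of times at which the orbits of
  \<open>x\<close> and \<open>y\<close> are \<open>\<delta>\<close>-separated.

  For an ultrametric, being closer than \<open>\<delta>\<close> is a transitive relation. So a time at which the
  orbits of \<open>x\<close> and \<open>z\<close> are separated is one at which those of \<open>x\<close> and \<open>y\<close> or those of \<open>y\<close> and
  \<open>z\<close> are separated, and the triangle inequality for \<^const>\<open>D_dist\<close> is the subadditivity of upper
  density.

  For the comparison of two metrics, both densities are compared with the density of the times at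
  which the sequences themselves disagree. On one side, a disagreement at coordinate \<open>0\<close> forces
  \<open>d \<ge> \<delta>\<close> by the choice of \<open>\<delta>\<^sub>0\<close>. On the other side, the full shift over a finite alphabet is
  compact, so \<open>d' \<ge> \<delta>'\<close> forces a disagreement inside a finite window \<open>F\<close> of coordinates that
  depends only on \<open>d'\<close> and \<open>\<delta>'\<close> (\<open>finite_window\<close>). Sliding the window along the orbits, each
  disagreement is seen from at most \<open>card F\<close> times, up to boundary effects bounded
  independently of \<open>n\<close> (\<open>card_translate_le\<close>). Division by \<open>n\<close> removes these boundary effects,
  so \<open>D_dist d' \<delta>' \<le> C * D_dist d \<delta>\<close> with \<open>C = card F + 1\<close>. Exchanging the
  metrics gives the other bound.
\<close>

section \<open>Upper densities\<close>

lemma funpow_shift: "(shift ^^ k) x = (\<lambda>n. x (n + int k))"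
  by (induction k) (auto simp: shift_def algebra_simps)

text \<open>This lemma and the next one replace the extended real upper limit by
  \<open>\<epsilon>\<close>-estimates between real numbers.\<close>

lemma eventually_separation_freq_less:
  assumes "e > 0"
  shows "\<forall>\<^sub>F n in sequentially. separation_freq d \<delta> x y n < D_dist d \<delta> x y + e"
proof -
  have "limsup (\<lambda>n. ereal (separation_freq d \<delta> x y n)) < ereal (D_dist d \<delta> x y + e)"
    using assms by (simp flip: ereal_D_dist)
  from Limsup_lessD[OF this] show ?thesis by simp
qed

lemma D_dist_leI:
  assumes "\<And>e. e > 0 \<Longrightarrow> \<forall>\<^sub>F n in sequentially. separation_freq d \<delta> x y n \<le> a + e"
  shows "D_dist d \<delta> x y \<le> a"
proof (rule field_le_epsilon)
  fix e :: real
  assume "e > 0"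
  then have "limsup (\<lambda>n. ereal (separation_freq d \<delta> x y n)) \<le> ereal (a + e)"
    using assms by (intro Limsup_bounded) simp
  then show "D_dist d \<delta> x y \<le> a + e"
    by (simp flip: ereal_D_dist)
qed

lemma D_dist_nonneg: "0 \<le> D_dist d \<delta> x y"
proof -
  have "0 \<le> limsup (\<lambda>n. ereal (separation_freq d \<delta> x y n))"
    by (rule le_Limsup) (simp_all add: separation_freq_bounds)
  then show ?thesis by (simp flip: ereal_D_dist)
qed

lemma D_dist_triangle:
  assumes "\<And>x y z. d x z \<ge> \<delta> \<Longrightarrow> d x y \<ge> \<delta> \<or> d y z \<ge> \<delta>"
  shows "D_dist d \<delta> x z \<le> D_dist d \<delta> x y + D_dist d \<delta> y z"
proof (rule D_dist_leI)
  fix e :: real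
  assume "e > 0"
  have freq: "separation_freq d \<delta> x z n \<le> separation_freq d \<delta> x y n + separation_freq d \<delta> y z n"
    for n
  proof -
    let ?S = "\<lambda>x y. {k. k < n \<and> d ((shift ^^ k) x) ((shift ^^ k) y) \<ge> \<delta>}"
    have "card (?S x z) \<le> card (?S x y \<union> ?S y z)"
      using assms by (intro card_mono) auto
    also have "\<dots> \<le> card (?S x y) + card (?S y z)"
      by (rule card_Un_le)
    finally have "real (card (?S x z)) \<le> real (card (?S x y)) + real (card (?S y z))"
      by simp
    then show ?thesis
      by (simp add: separation_freq_def divide_right_mono flip: add_divide_distrib)
  qed
  from \<open>e > 0\<close> have "e / 2 > 0" by simp
  note less = eventually_separation_freq_less[OF this]
  show "\<forall>\<^sub>F n in sequentially.
      separation_freq d \<delta> x z n \<le> D_dist d \<delta> x y + D_dist d \<delta> y z + e"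
    using less[of d \<delta> x y] less[of d \<delta> y z]
  proof eventually_elim
    case (elim n)
    then show ?case using freq[of n] by simp
  qed
qed

text \<open>The additive error \<open>K\<close> absorbs the boundary effects; it vanishes in the density because it
  does not depend on \<open>n\<close>.\<close>

lemma D_dist_le_mult:
  assumes count: "\<And>n. card {k. k < n \<and> d' ((shift ^^ k) x) ((shift ^^ k) y) \<ge> \<delta>'}
      \<le> C * card {k. k < n \<and> d ((shift ^^ k) x) ((shift ^^ k) y) \<ge> \<delta>} + K"
    and "C > 0"
  shows "D_dist d' \<delta>' x y \<le> real C * D_dist d \<delta> x y"
proof (rule D_dist_leI)
  fix e :: real
  assume "e > 0"
  have freq: "separation_freq d' \<delta>' x y n \<le> C * separation_freq d \<delta> x y n + real K / real n" for n
    using divide_right_mono[OF of_nat_mono[OF count[of n]], of "real n"]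
    by (simp add: separation_freq_def add_divide_distrib)
  have "(\<lambda>n. real K / real n) \<longlonglongrightarrow> 0"
    by (rule lim_const_over_n)
  then have "\<forall>\<^sub>F n in sequentially. real K / real n < e / 2"
    using \<open>e > 0\<close> by (intro order_tendstoD) auto
  moreover have "\<forall>\<^sub>F n in sequentially.
      separation_freq d \<delta> x y n < D_dist d \<delta> x y + e / (2 * C)"
    using \<open>e > 0\<close> \<open>C > 0\<close> by (intro eventually_separation_freq_less) simp
  ultimately show "\<forall>\<^sub>F n in sequentially.
      separation_freq d' \<delta>' x y n \<le> real C * D_dist d \<delta> x y + e"
  proof eventually_elim
    case (elim n)
    have "C * separation_freq d \<delta> x y n \<le> C * (D_dist d \<delta> x y + e / (2 * C))"
      using elim by (intro mult_left_mono) auto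
    also have "\<dots> = C * D_dist d \<delta> x y + e / 2"
      using \<open>C > 0\<close> by (simp add: field_simps)
    finally show ?case using elim freq[of n] by linarith
  qed
qed

section \<open>Comparison with coordinatewise disagreement\<close>

text \<open>This is uniform continuity of the identity from the product uniformity to the metric, so it
  is the usual Lebesgue number argument: each point has a basic open neighbourhood whose points
  are pairwise closer than \<open>\<delta>\<close> and which constrains finitely many coordinates, and finitely many
  of these cover the compact space.\<close>

lemma finite_window:
  fixes d :: "(int \<Rightarrow> 'a::finite) \<Rightarrow> (int \<Rightarrow> 'a) \<Rightarrow> real"
  assumes d: "metric_inducing_product_topology d" and "\<delta> > 0"
  obtains F :: "int set"
    where "finite F" and "\<And>x y. d x y \<ge> \<delta> \<Longrightarrow> \<exists>i\<in>F. x i \<noteq> y i"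
proof -
  let ?T = "product_topology (\<lambda>_::int. discrete_topology (UNIV :: 'a set)) UNIV"
  interpret Metric_space UNIV d
    using d by (simp add: metric_inducing_product_topology_def)
  have top: "mtopology = ?T"
    using d by (simp add: metric_inducing_product_topology_def)
  have "\<exists>U. finite {i. U i \<noteq> UNIV} \<and> x \<in> Pi\<^sub>E UNIV U \<and> Pi\<^sub>E UNIV U \<subseteq> mball x (\<delta> / 2)" for x
  proof -
    have "openin ?T (mball x (\<delta> / 2))"
      using openin_mball[of x "\<delta> / 2"] by (simp add: top)
    moreover have "x \<in> mball x (\<delta> / 2)"
      using \<open>\<delta> > 0\<close> by simp
    ultimately show ?thesis
      unfolding openin_product_topology_alt by auto
  qed
  then obtain U where fin: "\<And>x. finite {i. U x i \<noteq> UNIV}"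
    and mem: "\<And>x. x \<in> Pi\<^sub>E UNIV (U x)"
    and ball: "\<And>x. Pi\<^sub>E UNIV (U x) \<subseteq> mball x (\<delta> / 2)"
    by metis
  have "openin ?T (Pi\<^sub>E UNIV (U x))" for x
    using fin[of x] by (auto simp: openin_PiE_gen)
  moreover have "compact_space ?T"
    by (simp add: compact_space_product_topology compact_space_discrete_topology)
  moreover have "topspace ?T \<subseteq> \<Union> (range (\<lambda>x. Pi\<^sub>E UNIV (U x)))"
    using mem by blast
  ultimately obtain \<V> where \<V>: "finite \<V>" "\<V> \<subseteq> range (\<lambda>x. Pi\<^sub>E UNIV (U x))"
      "topspace ?T \<subseteq> \<Union> \<V>"
    unfolding compact_space_alt
    by (elim allE[of _ "range (\<lambda>x. Pi\<^sub>E UNIV (U x))"] impE) blast+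
  from finite_subset_image[OF \<V>(1,2)] obtain X
    where "finite X" and X: "\<V> = (\<lambda>x. Pi\<^sub>E UNIV (U x)) ` X"
    by blast
  have cover: "\<exists>x\<in>X. y \<in> Pi\<^sub>E UNIV (U x)" for y
  proof -
    have "y \<in> topspace ?T" by simp
    with \<V>(3) show ?thesis unfolding X by blast
  qed
  show thesis
  proof
    show "finite (\<Union>x\<in>X. {i. U x i \<noteq> UNIV})"
      using \<open>finite X\<close> fin by blast
  next
    fix y z
    assume "d y z \<ge> \<delta>"
    show "\<exists>i\<in>(\<Union>x\<in>X. {i. U x i \<noteq> UNIV}). y i \<noteq> z i"
    proof (rule ccontr)
      assume agree: "\<not> ?thesis"
      obtain x where "x \<in> X" and y: "y \<in> Pi\<^sub>E UNIV (U x)"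
        using cover by blast
      have "z i \<in> U x i" for i
      proof (cases "U x i = UNIV")
        case False
        then have "y i = z i" using agree \<open>x \<in> X\<close> by blast
        then show ?thesis using y by (metis PiE_mem UNIV_I)
      qed simp
      then have z: "z \<in> Pi\<^sub>E UNIV (U x)" by auto
      have "d x y < \<delta> / 2" "d x z < \<delta> / 2"
        using ball[of x] y z by auto
      then show False
        using \<open>d y z \<ge> \<delta>\<close> triangle[of y x z] by (simp add: commute[of y x])
    qed
  qed
qed

text \<open>Translating the window \<open>{0..<n}\<close> by \<open>j\<close> moves only \<open>\<bar>j\<bar>\<close> of its points outside.\<close>

lemma card_translate_le:
  fixes j :: int
  shows "card {k. k < n \<and> Q (int k + j)} \<le> card {k. k < n \<and> Q (int k)} + nat \<bar>j\<bar>"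
proof -
  let ?A = "{k. k < n \<and> Q (int k + j)}" and ?B = "{k. k < n \<and> Q (int k)}"
  let ?E = "if j \<ge> 0 then {int n..<int n + j} else {j..<0}"
  have "card ?A = card ((\<lambda>k. int k + j) ` ?A)"
    by (rule card_image[symmetric]) (simp add: inj_on_def)
  also have "\<dots> \<le> card (int ` ?B \<union> ?E)"
  proof (rule card_mono)
    show "(\<lambda>k. int k + j) ` ?A \<subseteq> int ` ?B \<union> ?E"
    proof (rule image_subsetI)
      fix k assume k: "k \<in> ?A"
      show "int k + j \<in> int ` ?B \<union> ?E"
      proof (cases "0 \<le> int k + j \<and> int k + j < int n")
        case True
        then have "nat (int k + j) \<in> ?B" using k by auto
        then have "int (nat (int k + j)) \<in> int ` ?B" by (rule imageI)
        with True show ?thesis by simp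
      qed (use k in auto)
    qed
  qed auto
  also have "\<dots> \<le> card (int ` ?B) + card ?E"
    by (rule card_Un_le)
  also have "\<dots> = card ?B + nat \<bar>j\<bar>"
    by (simp add: card_image)
  finally show ?thesis .
qed

lemma D_dist_comparison:
  fixes d d' :: "(int \<Rightarrow> 'a::finite) \<Rightarrow> (int \<Rightarrow> 'a) \<Rightarrow> real"
  assumes d0: "is_delta0 d \<delta>\<^sub>0" and "\<delta> \<le> \<delta>\<^sub>0"
    and d': "metric_inducing_product_topology d'" "\<delta>' > 0"
  shows "\<exists>C>0. \<forall>x y. D_dist d' \<delta>' x y \<le> C * D_dist d \<delta> x y"
proof -
  obtain F :: "int set" where "finite F"
    and F: "\<And>x y. d' x y \<ge> \<delta>' \<Longrightarrow> \<exists>i\<in>F. x i \<noteq> y i"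
    using finite_window[OF d'] by blast
  \<comment> \<open>The successor keeps the constant positive when \<open>F\<close> is empty.\<close>
  have "D_dist d' \<delta>' x y \<le> real (Suc (card F)) * D_dist d \<delta> x y" for x y
  proof (rule D_dist_le_mult)
    fix n
    let ?S' = "{k. k < n \<and> d' ((shift ^^ k) x) ((shift ^^ k) y) \<ge> \<delta>'}"
    let ?S = "{k. k < n \<and> d ((shift ^^ k) x) ((shift ^^ k) y) \<ge> \<delta>}"
    let ?N = "\<lambda>j. {k. k < n \<and> x (int k + j) \<noteq> y (int k + j)}"
    have "?S' \<subseteq> (\<Union>j\<in>F. ?N j)"
    proof
      fix k assume k: "k \<in> ?S'"
      then obtain j where "j \<in> F" "(shift ^^ k) x j \<noteq> (shift ^^ k) y j"
        using F by blast
      with k show "k \<in> (\<Union>j\<in>F. ?N j)"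
        by (auto simp: funpow_shift add.commute)
    qed
    then have "card ?S' \<le> card (\<Union>j\<in>F. ?N j)"
      using \<open>finite F\<close> by (intro card_mono) auto
    also have "\<dots> \<le> (\<Sum>j\<in>F. card (?N j))"
      by (rule card_UN_le[OF \<open>finite F\<close>])
    also have "\<dots> \<le> (\<Sum>j\<in>F. card ?S + nat \<bar>j\<bar>)"
    proof (rule sum_mono)
      fix j
      have "\<delta> \<le> d u v" if "u 0 \<noteq> v 0" for u v
        using d0 \<open>\<delta> \<le> \<delta>\<^sub>0\<close> that unfolding is_delta0_def by (meson order_trans)
      then have "?N 0 \<subseteq> ?S"
        by (intro Collect_mono impI conjI) (simp_all add: funpow_shift)
      then have "card (?N 0) \<le> card ?S"
        by (intro card_mono) auto
      then show "card (?N j) \<le> card ?S + nat \<bar>j\<bar>"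
        using card_translate_le[of n "\<lambda>i. x i \<noteq> y i" j] by simp
    qed
    also have "\<dots> \<le> Suc (card F) * card ?S + (\<Sum>j\<in>F. nat \<bar>j\<bar>)"
      by (simp add: sum.distrib)
    finally show "card ?S' \<le> Suc (card F) * card ?S + (\<Sum>j\<in>F. nat \<bar>j\<bar>)" .
  qed simp
  moreover have "real (Suc (card F)) > 0"
    by simp
  ultimately show ?thesis by blast
qed

section \<open>The pseudometric property and independence of the metric\<close>

lemma pseudometric_D_dist:
  fixes d :: "(int \<Rightarrow> 'a) \<Rightarrow> (int \<Rightarrow> 'a) \<Rightarrow> real"
  assumes "ultrametric d" and "\<delta> > 0"
  shows "pseudometric (D_dist d \<delta>)"
proof -
  interpret Metric_space UNIV d
    using assms by (simp add: ultrametric_def)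
  have "separation_freq d \<delta> x x = (\<lambda>n. 0)" for x
    using \<open>\<delta> > 0\<close> by (simp add: separation_freq_def fun_eq_iff)
  then have refl: "D_dist d \<delta> x x = 0" for x
    by (simp add: D_dist_def Limsup_const flip: zero_ereal_def)
  have sym: "D_dist d \<delta> x y = D_dist d \<delta> y x" for x y
    by (simp add: D_dist_def separation_freq_def commute)
  have tri: "D_dist d \<delta> x z \<le> D_dist d \<delta> x y + D_dist d \<delta> y z" for x y z
  proof (rule D_dist_triangle)
    fix x y z
    assume "d x z \<ge> \<delta>"
    moreover have "d x z \<le> max (d x y) (d y z)"
      using \<open>ultrametric d\<close> by (simp add: ultrametric_def)
    ultimately show "d x y \<ge> \<delta> \<or> d y z \<ge> \<delta>" by linarith
  qed
  show ?thesis
    unfolding pseudometric_def by (intro conjI allI D_dist_nonneg refl sym tri)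
qed

theorem lemma6p2:
  shows "(\<forall>(d :: (int \<Rightarrow> 'a::finite) \<Rightarrow> (int \<Rightarrow> 'a) \<Rightarrow> real) \<delta>.
            ultrametric d \<and> metric_inducing_product_topology d \<and> \<delta> > 0 \<longrightarrow>
            pseudometric (D_dist d \<delta>)) \<and>
         (\<forall>(d :: (int \<Rightarrow> 'a) \<Rightarrow> (int \<Rightarrow> 'a) \<Rightarrow> real) d' \<delta>\<^sub>0 \<delta>\<^sub>0' \<delta> \<delta>'.
            metric_inducing_product_topology d \<and> metric_inducing_product_topology d' \<and>
            is_delta0 d \<delta>\<^sub>0 \<and> is_delta0 d' \<delta>\<^sub>0' \<and>
            \<delta> \<in> {0<..\<delta>\<^sub>0} \<and> \<delta>' \<in> {0<..\<delta>\<^sub>0'} \<longrightarrow>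
            (\<exists>c C. c > 0 \<and> C > 0 \<and>
              (\<forall>x y. c * D_dist d \<delta> x y \<le> D_dist d' \<delta>' x y \<and>
                     D_dist d' \<delta>' x y \<le> C * D_dist d \<delta> x y)))"
proof (intro conjI allI impI)
  fix d :: "(int \<Rightarrow> 'a) \<Rightarrow> (int \<Rightarrow> 'a) \<Rightarrow> real" and \<delta> :: real
  assume "ultrametric d \<and> metric_inducing_product_topology d \<and> \<delta> > 0"
  then show "pseudometric (D_dist d \<delta>)"
    by (simp add: pseudometric_D_dist)
next
  fix d d' :: "(int \<Rightarrow> 'a) \<Rightarrow> (int \<Rightarrow> 'a) \<Rightarrow> real" and \<delta>\<^sub>0 \<delta>\<^sub>0' \<delta> \<delta>' :: real
  assume "metric_inducing_product_topology d \<and> metric_inducing_product_topology d' \<and>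
    is_delta0 d \<delta>\<^sub>0 \<and> is_delta0 d' \<delta>\<^sub>0' \<and> \<delta> \<in> {0<..\<delta>\<^sub>0} \<and> \<delta>' \<in> {0<..\<delta>\<^sub>0'}"
  then have d: "metric_inducing_product_topology d" "\<delta> > 0" "is_delta0 d \<delta>\<^sub>0" "\<delta> \<le> \<delta>\<^sub>0"
    and d': "metric_inducing_product_topology d'" "\<delta>' > 0" "is_delta0 d' \<delta>\<^sub>0'" "\<delta>' \<le> \<delta>\<^sub>0'"
    by auto
  obtain C where C: "C > 0" "\<And>x y. D_dist d' \<delta>' x y \<le> C * D_dist d \<delta> x y"
    using D_dist_comparison[OF d(3,4) d'(1,2)] by blast
  obtain C' where C': "C' > 0" "\<And>x y. D_dist d \<delta> x y \<le> C' * D_dist d' \<delta>' x y"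
    using D_dist_comparison[OF d'(3,4) d(1,2)] by blast
  have "1 / C' * D_dist d \<delta> x y \<le> D_dist d' \<delta>' x y" for x y
    using C'(1) C'(2)[of x y] by (simp add: field_simps)
  with C C'(1) show "\<exists>c C. c > 0 \<and> C > 0 \<and>
      (\<forall>x y. c * D_dist d \<delta> x y \<le> D_dist d' \<delta>' x y \<and> D_dist d' \<delta>' x y \<le> C * D_dist d \<delta> x y)"
    by (intro exI[of _ "1 / C'"] exI[of _ C]) simp
qed

end
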